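(* Let $X$ be a Hilbert space over $\mathbb{K}$ ($\mathbb{K}=\mathbb{R}$ or $\mathbb{C}$), let $N\ge 2$ be an integer, $T>0$, $\Delta t = T/(N-1)$, and let $u^1,\dots,u^N\in X$. Put $\partial u^i = \frac{u^{i+1}-u^i}{\Delta t}$ for $i=1,\dots,N-1$, and define $w^1=u^1$ and $w^{i+1}=\partial u^i$ for $i=1,\dots,N-1$. If $\{u^i\}_{i=1}^N$ is linearly independent, then $\{w^i\}_{i=1}^N$ is linearly independent.
   Context: All notation is introduced in the claim. *)

theory Defs
  imports "HOL-Analysis.Analysis"
begin

text \<open>Real Hilbert spaces are the types of sort \<open>{real_inner, complete_space}\<close>.  The classes
  below are the complex counterpart; the real scaling is the restriction of the complex one,
  so that \<open>scaleR\<close> may be used in spaces over either field.\<close>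

class complex_vector = real_vector +
  fixes scaleC :: "complex \<Rightarrow> 'a \<Rightarrow> 'a"  (infixr "*\<^sub>C" 75)
  assumes scaleC_add_right: "a *\<^sub>C (x + y) = a *\<^sub>C x + a *\<^sub>C y"
    and scaleC_add_left: "(a + b) *\<^sub>C x = a *\<^sub>C x + b *\<^sub>C x"
    and scaleC_scaleC: "a *\<^sub>C b *\<^sub>C x = (a * b) *\<^sub>C x"
    and scaleC_one: "1 *\<^sub>C x = x"
    and scaleR_scaleC: "r *\<^sub>R x = complex_of_real r *\<^sub>C x"

class complex_inner = complex_vector + real_normed_vector +
  fixes cinner :: "'a \<Rightarrow> 'a \<Rightarrow> complex"
  assumes cinner_commute: "cinner x y = cnj (cinner y x)"
    and cinner_add_left: "cinner (x + y) z = cinner x z + cinner y z"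
    and cinner_scaleC_left: "cinner (a *\<^sub>C x) y = a * cinner x y"
    and cinner_ge_zero: "0 \<le> Re (cinner x x)"  \<comment> \<open>\<open>cinner x x\<close> is real by \<open>cinner_commute\<close>\<close>
    and cinner_eq_zero_iff: "cinner x x = 0 \<longleftrightarrow> x = 0"
    and norm_eq_sqrt_cinner: "norm x = sqrt (Re (cinner x x))"

class complex_hilbert_space = complex_inner + complete_space

lemma vector_space_scaleC: "vector_space (scaleC :: complex \<Rightarrow> 'a \<Rightarrow> 'a::complex_vector)"
  by unfold_locales
    (simp_all add: scaleC_add_right scaleC_add_left scaleC_scaleC scaleC_one)

instantiation complex :: complex_hilbert_space
begin

definition scaleC_complex :: "complex \<Rightarrow> complex \<Rightarrow> complex" where
  "scaleC_complex a x = a * x"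

definition cinner_complex :: "complex \<Rightarrow> complex \<Rightarrow> complex" where
  "cinner_complex x y = x * cnj y"

instance
  by intro_classes
    (auto simp: scaleC_complex_def cinner_complex_def algebra_simps scaleR_conv_of_real
      cmod_def power2_eq_square)

end

text \<open>Linear independence of a family, as opposed to that of its set of members: a family
  with a repeated member is dependent.\<close>

definition independent_family ::
  "('k::field \<Rightarrow> 'a \<Rightarrow> 'a::ab_group_add) \<Rightarrow> ('i \<Rightarrow> 'a) \<Rightarrow> 'i set \<Rightarrow> bool" where
  "independent_family scl u I \<longleftrightarrow> inj_on u I \<and> \<not> module.dependent scl (u ` I)"

definition diff_quot :: "real \<Rightarrow> (nat \<Rightarrow> 'a::real_vector) \<Rightarrow> nat \<Rightarrow> 'a" where
  "diff_quot dt u i = (u (i + 1) - u i) /\<^sub>R dt"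

text \<open>Families are indexed from 1; the value at 0 is irrelevant.\<close>

definition diff_quot_family :: "real \<Rightarrow> (nat \<Rightarrow> 'a::real_vector) \<Rightarrow> nat \<Rightarrow> 'a" where
  "diff_quot_family dt u i = (if i = 1 then u 1 else diff_quot dt u (i - 1))"

end

theory Submission imports Defs begin

text \<open>The passage from \<open>u\<close> to \<open>w\<close> is triangular: \<open>w\<^sub>1 = u\<^sub>1\<close>, and for \<open>i > 1\<close> the vector
  \<open>w\<^sub>i = u\<^sub>i / \<Delta>t - u\<^bsub>i-1\<^esub> / \<Delta>t\<close> is a nonzero multiple of \<open>u\<^sub>i\<close> plus a vector in the span of the
  earlier members.  A triangular change of family with nonzero diagonal preserves the span of
  every initial segment (\<open>span_triangular\<close>).  Independence of a finite sequence means that no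
  member lies in the span of its predecessors (\<open>independent_family_Suc\<close>), and modulo that span
  \<open>w\<^sub>i\<close> is a nonzero multiple of \<open>u\<^sub>i\<close>; hence \<open>w\<close> inherits independence from \<open>u\<close>
  (\<open>independent_family_triangular\<close>).

  For \<open>i > 1\<close> the diagonal entry is \<open>1 / \<Delta>t\<close>, and \<open>N \<ge> 2\<close> and \<open>T > 0\<close> make \<open>\<Delta>t\<close> nonzero.
  The lemmas are proved over an arbitrary field, so that the real and the complex statement
  are two instances of the same fact.\<close>

context vector_space
begin

lemma independent_family_Suc:
  "independent_family scale u {1..Suc n} \<longleftrightarrow>
     independent_family scale u {1..n} \<and> u (Suc n) \<notin> span (u ` {1..n})"
proof -
  have "{1..Suc n} = insert (Suc n) {1..n}"
    by auto
  then show ?thesis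
    \<comment> \<open>A value \<open>u (Suc n)\<close> equal to an earlier one violates both sides: injectivity on the left, and on the
      right the span condition, since a set is contained in its span.\<close>
    by (auto simp: independent_family_def independent_insert inj_on_insert span_base
        split: if_splits)
qed

lemma scale_add_in_span_iff:
  assumes "c \<noteq> 0" and "x \<in> span S"
  shows "scale c a + x \<in> span S \<longleftrightarrow> a \<in> span S"
proof -
  have "scale c a + x \<in> span S \<longleftrightarrow> scale c a \<in> span S"
    using assms(2) by (simp add: span_add_eq2)
  also have "\<dots> \<longleftrightarrow> a \<in> span S"
  proof
    assume "scale c a \<in> span S"
    then have "scale (inverse c) (scale c a) \<in> span S"
      by (rule span_scale)
    then show "a \<in> span S"
      using assms(1) by simp
  qed (rule span_scale)
  finally show ?thesis .
qed

text \<open>Since the diagonal coefficient is invertible, each of \<open>u (Suc i)\<close> and \<open>w (Suc i)\<close> can be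
  solved for in terms of the other and the common span of the earlier members.\<close>

lemma span_triangular:
  assumes "\<And>i. i < n \<Longrightarrow> \<exists>c x. c \<noteq> 0 \<and> x \<in> span (u ` {1..i}) \<and> w (Suc i) = scale c (u (Suc i)) + x"
  shows "span (w ` {1..n}) = span (u ` {1..n})"
  using assms
proof (induction n)
  case 0
  show ?case by simp
next
  case (Suc n)
  have IH: "span (w ` {1..n}) = span (u ` {1..n})"
    using Suc by simp
  obtain c x where c: "c \<noteq> 0" and x: "x \<in> span (u ` {1..n})"
    and w: "w (Suc n) = scale c (u (Suc n)) + x"
    using Suc.prems[of n] by auto
  have seg: "{1..Suc n} = insert (Suc n) {1..n}"
    by auto
  let ?U = "u ` {1..Suc n}" and ?W = "w ` {1..Suc n}"
  have U: "span (u ` {1..n}) \<subseteq> span ?U"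
    by (intro span_mono image_mono) simp
  have W: "span (u ` {1..n}) \<subseteq> span ?W"
    unfolding IH[symmetric] by (intro span_mono image_mono) simp
  have "w (Suc n) \<in> span ?W" "u (Suc n) \<in> span ?U"
    by (simp_all add: span_base)
  then have "w (Suc n) \<in> span ?U" "u (Suc n) \<in> span ?W"
    using scale_add_in_span_iff[OF c, of x] x U W w by auto
  moreover have "w ` {1..n} \<subseteq> span ?U" "u ` {1..n} \<subseteq> span ?W"
    using span_superset[of "w ` {1..n}"] span_superset[of "u ` {1..n}"] IH U W by auto
  ultimately have "?W \<subseteq> span ?U" "?U \<subseteq> span ?W"
    by (simp_all only: seg image_insert insert_subset simp_thms)
  then show ?case
    by (simp add: span_eq)
qed

lemma independent_family_triangular:
  assumes "\<And>i. i < n \<Longrightarrow> \<exists>c x. c \<noteq> 0 \<and> x \<in> span (u ` {1..i}) \<and> w (Suc i) = scale c (u (Suc i)) + x"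
    and "independent_family scale u {1..n}"
  shows "independent_family scale w {1..n}"
  using assms
proof (induction n)
  case 0
  show ?case by (simp add: independent_family_def independent_empty)
next
  case (Suc n)
  have "independent_family scale u {1..n}" and new: "u (Suc n) \<notin> span (u ` {1..n})"
    using Suc.prems(2) by (simp_all only: independent_family_Suc simp_thms)
  then have ind: "independent_family scale w {1..n}"
    using Suc.IH Suc.prems(1) by simp
  have eq: "span (w ` {1..n}) = span (u ` {1..n})"
    using Suc.prems(1) by (intro span_triangular) simp
  obtain c x where "c \<noteq> 0" "x \<in> span (u ` {1..n})" "w (Suc n) = scale c (u (Suc n)) + x"
    using Suc.prems(1)[of n] by auto
  with new have "w (Suc n) \<notin> span (w ` {1..n})"
    unfolding eq by (simp add: scale_add_in_span_iff)
  with ind show ?case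
    by (simp only: independent_family_Suc simp_thms)
qed

text \<open>The scalar \<open>k\<close> stands for \<open>1 / \<Delta>t\<close> in the field of the space, which lets the real and
  the complex case share one statement although difference quotients are formed with the real
  scaling.\<close>

lemma independent_family_differences:
  assumes "k \<noteq> 0" and "w 1 = u 1"
    and "\<And>i. i \<ge> 1 \<Longrightarrow> w (Suc i) = scale k (u (Suc i) - u i)"
    and "independent_family scale u {1..n}"
  shows "independent_family scale w {1..n}"
proof (rule independent_family_triangular[OF _ assms(4)])
  fix i
  show "\<exists>c x. c \<noteq> 0 \<and> x \<in> span (u ` {1..i}) \<and> w (Suc i) = scale c (u (Suc i)) + x"
  proof (cases "i = 0")
    case True
    then show ?thesis
      using assms(2) by (intro exI[of _ 1] exI[of _ 0]) simp
  next
    case False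
    then have "scale (- k) (u i) \<in> span (u ` {1..i})"
      by (intro span_scale span_base) auto
    moreover have "w (Suc i) = scale k (u (Suc i)) + scale (- k) (u i)"
      using False assms(3)[of i] by (simp add: scale_right_diff_distrib)
    ultimately show ?thesis
      using assms(1) by blast
  qed
qed

end

theorem lemma3p1:
  fixes N :: nat and T \<Delta>t :: real
    and u :: "nat \<Rightarrow> 'a::{real_inner, complete_space}"
    and v :: "nat \<Rightarrow> 'b::complex_hilbert_space"
  assumes "N \<ge> 2" and "T > 0" and "\<Delta>t = T / (real N - 1)"
  shows "(independent_family (scaleR :: real \<Rightarrow> 'a \<Rightarrow> 'a) u {1..N} \<longrightarrow>
            independent_family (scaleR :: real \<Rightarrow> 'a \<Rightarrow> 'a) (diff_quot_family \<Delta>t u) {1..N})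
       \<and> (independent_family (scaleC :: complex \<Rightarrow> 'b \<Rightarrow> 'b) v {1..N} \<longrightarrow>
            independent_family (scaleC :: complex \<Rightarrow> 'b \<Rightarrow> 'b) (diff_quot_family \<Delta>t v) {1..N})"
proof -
  have dt: "\<Delta>t \<noteq> 0"
    using assms by simp
  have real_case: "independent_family scaleR (diff_quot_family \<Delta>t u) {1..N}"
    if "independent_family (scaleR :: real \<Rightarrow> 'a \<Rightarrow> 'a) u {1..N}"
    by (rule real_vector.independent_family_differences[where k = "inverse \<Delta>t" and u = u, OF _ _ _ that])
      (simp_all add: dt diff_quot_family_def diff_quot_def)
  have complex_case: "independent_family scaleC (diff_quot_family \<Delta>t v) {1..N}"
    if "independent_family (scaleC :: complex \<Rightarrow> 'b \<Rightarrow> 'b) v {1..N}"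
    by (rule vector_space.independent_family_differences[OF vector_space_scaleC,
          where k = "complex_of_real (inverse \<Delta>t)" and u = v, OF _ _ _ that])
      (simp_all add: dt diff_quot_family_def diff_quot_def scaleR_scaleC)
  show ?thesis
    using real_case complex_case by blast
qed

end
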